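(* Let $T\ge 1$ be an integer and $\mu>0$. Suppose that for each $t$ the function $f_t:Q\to\mathbb{R}$ is $M_f$-relatively Lipschitz-continuous and $\mu$-strongly convex with respect to the prox-function $h$, and that $g:Q\to\mathbb{R}$ is $M_g$-relatively Lipschitz-continuous and $\mu$-strongly convex with respect to $h$. Put $M=\max\{M_f,M_g\}$ and $$\varepsilon=\frac{M^2}{\mu}\,\frac{1+\ln T}{T}.$$ Suppose that the switching Mirror Descent algorithm described in the context, run with this $\varepsilon$, makes exactly $T$ productive steps (and then stops), and that $\mathrm{Regret}_T\ge 0$. Then there exists a constant $C\in(2,3)$ (independent of $T$ and of the problem data) such that the number $T_J$ of non-productive steps satisfies $T_J\le CT$, and moreover $$\mathrm{Regret}_T\le \frac{M^2}{\mu}\Big(1+\ln\big((C+1)T\big)\Big)=O(T\varepsilon),$$ where $g(x_t)\le\varepsilon$ for every productive step $t\in I$.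
   Context: $Q\subset\mathbb{R}^n$ is a closed convex set, and $h$ is a convex, continuously differentiable function on $Q$ (prox-function). Its Bregman divergence is $V(y,x)=h(y)-h(x)-\langle\nabla h(x),y-x\rangle$. For a convex function $f$, $\nabla f(x)$ denotes its (sub)gradient at $x$ (the one used by the algorithm). A convex function $f:Q\to\mathbb{R}$ is $M$-relatively Lipschitz-continuous (with respect to $h$), $M>0$, if $\langle\nabla f(x),y-x\rangle+M\sqrt{2V(y,x)}\ge 0$ for all $x,y\in Q$. A function $f$ is $\mu$-strongly convex with respect to $h$ if $f(x)\ge f(y)+\langle\nabla f(y),x-y\rangle+\mu V(x,y)$ for all $x,y\in Q$. Algorithm. Given $\varepsilon>0$, $\mu>0$, $T$ and $x_1\in Q$, at iteration $t=1,2,\dots$ set $\eta_t=\frac{1}{\mu t}$. If $g(x_t)\le\varepsilon$ (step $t$ is "productive"), put $p_t=\nabla f_t(x_t)$; otherwise (step $t$ is "non-productive") put $p_t=\nabla g(x_t)$. Then perform the Mirror Descent step $$x_{t+1}=\arg\min_{x\in Q}\{\eta_t\langle p_t,x\rangle+V(x,x_t)\}$$ (the minimizer is assumed to exist). Stop as soon as $T$ productive steps have been made. $I$ and $J$ denote the sets of indices of productive and non-productive steps, $|I|=T$ and $|J|=T_J$, so that $t$ runs over $1,\dots,T+T_J$. The loss $f_t$ is used only when $t\in I$. The regret is $$\mathrm{Regret}_T=\sum_{t\in I}f_t(x_t)-\min_{x\in Q,\ g(x)\le 0}\ \sum_{t\in I}f_t(x),$$ where the minimum is assumed to be attained at some $x^*\in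 Q$ with $g(x^* )\le 0$. *)

theory Defs
  imports "HOL-Analysis.Analysis" "HOL-Analysis.Finite_Function_Topology"
begin

text \<open>
  The constant in the theorem must not depend on the dimension, so the dimension has to be an
  ordinary number that is quantified inside the statement. All spaces \<open>R^n\<close> are therefore taken as
  coordinate subspaces of the normed space of finitely supported real sequences. Its library norm
  is the \<open>l1\<close> norm; on \<open>Rn n\<close> it is equivalent to the Euclidean norm, so closedness, continuity
  and differentiability there are the usual ones.
\<close>

type_synonym rvec = "nat \<Rightarrow>\<^sub>0 real"

definition Rn :: "nat \<Rightarrow> rvec set" where
  "Rn n = {v. Poly_Mapping.keys v \<subseteq> {..<n}}"

definition dot :: "rvec \<Rightarrow> rvec \<Rightarrow> real" where
  "dot v w = (\<Sum>i\<in>Poly_Mapping.keys v. Poly_Mapping.lookup v i * Poly_Mapping.lookup w i)"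

text \<open>
  Gradients and subgradients are carried as explicit maps: \<open>h'\<close>, \<open>f'\<close>, \<open>g'\<close> are the gradient of \<open>h\<close>
  and the subgradient selections of \<open>f\<close>, \<open>g\<close> that the algorithm uses. The derivative is taken
  within \<open>Q\<close>, so points on the boundary of \<open>Q\<close> are covered.
\<close>

definition cont_diff_on :: "nat \<Rightarrow> rvec set \<Rightarrow> (rvec \<Rightarrow> real) \<Rightarrow> (rvec \<Rightarrow> rvec) \<Rightarrow> bool" where
  "cont_diff_on n Q h h' \<longleftrightarrow>
     (\<forall>x\<in>Q. h' x \<in> Rn n \<and> (h has_derivative dot (h' x)) (at x within Q)) \<and> continuous_on Q h'"

definition subgradient_on :: "nat \<Rightarrow> rvec set \<Rightarrow> (rvec \<Rightarrow> real) \<Rightarrow> (rvec \<Rightarrow> rvec) \<Rightarrow> bool" where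
  "subgradient_on n Q f f' \<longleftrightarrow>
     (\<forall>x\<in>Q. f' x \<in> Rn n \<and> (\<forall>y\<in>Q. f y \<ge> f x + dot (f' x) (y - x)))"

definition bregman :: "(rvec \<Rightarrow> real) \<Rightarrow> (rvec \<Rightarrow> rvec) \<Rightarrow> rvec \<Rightarrow> rvec \<Rightarrow> real" where
  "bregman h h' y x = h y - h x - dot (h' x) (y - x)"

definition rel_Lipschitz ::
  "(rvec \<Rightarrow> real) \<Rightarrow> (rvec \<Rightarrow> rvec) \<Rightarrow> rvec set \<Rightarrow> real \<Rightarrow> (rvec \<Rightarrow> real) \<Rightarrow> (rvec \<Rightarrow> rvec) \<Rightarrow> bool" where
  "rel_Lipschitz h h' Q M f f' \<longleftrightarrow>
     M > 0 \<and> convex_on Q f \<and>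
     (\<forall>x\<in>Q. \<forall>y\<in>Q. dot (f' x) (y - x) + M * sqrt (2 * bregman h h' y x) \<ge> 0)"

definition rel_strongly_convex ::
  "(rvec \<Rightarrow> real) \<Rightarrow> (rvec \<Rightarrow> rvec) \<Rightarrow> rvec set \<Rightarrow> real \<Rightarrow> (rvec \<Rightarrow> real) \<Rightarrow> (rvec \<Rightarrow> rvec) \<Rightarrow> bool" where
  "rel_strongly_convex h h' Q \<mu> f f' \<longleftrightarrow>
     (\<forall>x\<in>Q. \<forall>y\<in>Q. f x \<ge> f y + dot (f' y) (x - y) + \<mu> * bregman h h' x y)"

definition productive :: "(rvec \<Rightarrow> real) \<Rightarrow> real \<Rightarrow> (nat \<Rightarrow> rvec) \<Rightarrow> nat \<Rightarrow> nat set" where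
  "productive g \<epsilon> x N = {t \<in> {1..N}. g (x t) \<le> \<epsilon>}"

definition nonproductive :: "(rvec \<Rightarrow> real) \<Rightarrow> real \<Rightarrow> (nat \<Rightarrow> rvec) \<Rightarrow> nat \<Rightarrow> nat set" where
  "nonproductive g \<epsilon> x N = {1..N} - productive g \<epsilon> x N"

text \<open>
  \<open>x 1, \<dots>, x (N + 1)\<close> are iterates of a run that performs exactly the iterations \<open>1, \<dots>, N\<close>:
  \<open>N\<close> is the first iteration after which \<open>T\<close> productive steps have been made.
\<close>

definition switching_MD_run ::
  "rvec set \<Rightarrow> (rvec \<Rightarrow> real) \<Rightarrow> (rvec \<Rightarrow> rvec) \<Rightarrow> (nat \<Rightarrow> rvec \<Rightarrow> rvec) \<Rightarrow>
   (rvec \<Rightarrow> real) \<Rightarrow> (rvec \<Rightarrow> rvec) \<Rightarrow> real \<Rightarrow> real \<Rightarrow> nat \<Rightarrow> (nat \<Rightarrow> rvec) \<Rightarrow> nat \<Rightarrow> bool" where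
  "switching_MD_run Q h h' f' g g' \<epsilon> \<mu> T x N \<longleftrightarrow>
     x 1 \<in> Q \<and>
     (\<forall>t\<in>{1..N}.
        let \<eta> = 1 / (\<mu> * real t);
            p = (if g (x t) \<le> \<epsilon> then f' t (x t) else g' (x t))
        in is_arg_min (\<lambda>y. \<eta> * dot p y + bregman h h' y (x t)) (\<lambda>y. y \<in> Q) (x (Suc t))) \<and>
     card (productive g \<epsilon> x N) = T \<and>
     (\<forall>k<N. card (productive g \<epsilon> x k) < T)"

definition regret ::
  "rvec set \<Rightarrow> (nat \<Rightarrow> rvec \<Rightarrow> real) \<Rightarrow> (rvec \<Rightarrow> real) \<Rightarrow> nat set \<Rightarrow> (nat \<Rightarrow> rvec) \<Rightarrow> real" where
  "regret Q f g I x =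
     (\<Sum>t\<in>I. f t (x t)) - (INF z\<in>{z\<in>Q. g z \<le> 0}. \<Sum>t\<in>I. f t z)"

end

theory Submission
  imports Defs
begin

text \<open>
  One Mirror Descent step with step size \<open>1 / (\<mu> * t)\<close> costs at most
  \<open>\<mu> * t * (V(y, x\<^sub>t) - V(y, x\<^sub>t\<^sub>+\<^sub>1)) + M\<^sup>2 / (2 * \<mu> * t)\<close>; strong convexity lowers this by
  \<open>\<mu> * V(y, x\<^sub>t)\<close>, so the sum over all steps telescopes and leaves a harmonic sum. Every
  non-productive step contributes more than \<open>\<epsilon>\<close>, so
  \<open>Regret + \<epsilon> * T\<^sub>J \<le> M\<^sup>2 / (2 * \<mu>) * (1 + ln (T + T\<^sub>J))\<close>. A nonnegative regret then forces
  \<open>r = T\<^sub>J / T\<close> to satisfy \<open>2 * r \<le> 1 + ln (1 + r)\<close>, hence \<open>r \<le> 1\<close>.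
\<close>

section \<open>Linearity of \<open>dot\<close> in its second argument\<close>

lemma dot_add_right: "dot v (w + z) = dot v w + dot v z"
  by (simp add: dot_def lookup_add ring_distribs sum.distrib)

lemma dot_diff_right: "dot v (w - z) = dot v w - dot v z"
  by (simp add: dot_def lookup_minus ring_distribs sum_subtractf)

lemma lookup_scaleR: "Poly_Mapping.lookup (c *\<^sub>R w) i = c *\<^sub>R Poly_Mapping.lookup w i"
proof -
  have "{i. c *\<^sub>R Poly_Mapping.lookup w i \<noteq> 0} \<subseteq> Poly_Mapping.keys w"
    by (auto simp: in_keys_iff)
  then have "finite {i. c *\<^sub>R Poly_Mapping.lookup w i \<noteq> 0}"
    using finite_keys finite_subset by blast
  then show ?thesis by (simp add: scaleR_poly_mapping_def)
qed

lemma dot_scaleR_right: "dot v (c *\<^sub>R w) = c * dot v w"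
  by (simp add: dot_def lookup_scaleR sum_distrib_left mult_ac)

section \<open>One-sided derivatives along segments of a convex set\<close>

lemma directional_derivative_on_convex:
  fixes h :: "'a::real_normed_vector \<Rightarrow> real"
  assumes "convex Q" "x \<in> Q" "y \<in> Q" and h: "(h has_derivative D) (at x within Q)"
  shows "((\<lambda>s. (h (x + s *\<^sub>R (y - x)) - h x) / s) \<longlongrightarrow> D (y - x)) (at_right 0)"
proof -
  have lin: "(\<lambda>s. D (s *\<^sub>R (y - x))) = (*) (D (y - x))"
    using has_derivative_bounded_linear[OF h] by (simp add: linear_simps fun_eq_iff)
  have sub: "(\<lambda>s. x + s *\<^sub>R (y - x)) ` {0..1} \<subseteq> Q"
  proof safe
    fix s :: real assume "s \<in> {0..1}"
    then have "(1 - s) *\<^sub>R x + s *\<^sub>R y \<in> Q"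
      using assms(1-3) by (auto intro: convexD_alt)
    then show "x + s *\<^sub>R (y - x) \<in> Q" by (simp add: algebra_simps)
  qed
  \<comment> \<open>The derivative of \<open>h\<close> is known only within \<open>Q\<close>,
    possibly at a boundary point. So the chain rule is applied within \<open>{0..1}\<close>, whose
    image stays in \<open>Q\<close>; at 0 this gives the right-hand limit.\<close>
  have "((\<lambda>s. x + s *\<^sub>R (y - x)) has_derivative (\<lambda>s. s *\<^sub>R (y - x))) (at 0 within {0..1})"
    by (auto intro!: derivative_eq_intros)
  moreover have "(h has_derivative D) (at (x + 0 *\<^sub>R (y - x)) within (\<lambda>s. x + s *\<^sub>R (y - x)) ` {0..1})"
    using has_derivative_subset[OF h sub] by simp
  ultimately have "((\<lambda>s. h (x + s *\<^sub>R (y - x))) has_derivative (\<lambda>s. D (s *\<^sub>R (y - x)))) (at 0 within {0..1})"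
    by (rule has_derivative_in_compose)
  then have "((\<lambda>s. h (x + s *\<^sub>R (y - x))) has_field_derivative D (y - x)) (at 0 within {0..1})"
    by (simp add: has_field_derivative_def lin)
  then show ?thesis
    by (simp add: has_field_derivative_iff at_within_Icc_at_right)
qed

text \<open>Lets \<open>s\<close> tend to 0 from the right in \<open>c\<close>. It serves twice: for
  \<open>- h\<close>, to make the Bregman divergence nonnegative, and for \<open>h\<close> at a
  minimizer, as the optimality condition.\<close>

lemma directional_derivative_ge:
  fixes h :: "'a::real_normed_vector \<Rightarrow> real"
  assumes "convex Q" "x \<in> Q" "y \<in> Q" "(h has_derivative D) (at x within Q)"
    and c: "\<And>s. 0 < s \<Longrightarrow> s \<le> 1 \<Longrightarrow> s * c \<le> h (x + s *\<^sub>R (y - x)) - h x"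
  shows "c \<le> D (y - x)"
proof (rule tendsto_lowerbound[OF directional_derivative_on_convex[OF assms(1-4)]])
  show "\<forall>\<^sub>F s in at_right 0. c \<le> (h (x + s *\<^sub>R (y - x)) - h x) / s"
    using eventually_at_right_real[OF zero_less_one]
  proof eventually_elim
    case (elim s)
    then show ?case using c[of s] by (simp add: field_simps)
  qed
qed simp

section \<open>Bregman divergence and a single Mirror Descent step\<close>

lemma bregman_nonneg:
  assumes "convex Q" "convex_on Q h" "cont_diff_on n Q h h'" and x: "x \<in> Q" and y: "y \<in> Q"
  shows "bregman h h' y x \<ge> 0"
proof -
  have h: "(h has_derivative dot (h' x)) (at x within Q)"
    using assms by (simp add: cont_diff_on_def)
  have "h x - h y \<le> - dot (h' x) (y - x)"
  proof (rule directional_derivative_ge[OF assms(1) x y has_derivative_minus[OF h]])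
    fix s :: real assume s: "0 < s" "s \<le> 1"
    have "h ((1 - s) *\<^sub>R x + s *\<^sub>R y) \<le> (1 - s) * h x + s * h y"
      using convex_onD[OF assms(2), of s x y] s x y by simp
    then show "s * (h x - h y) \<le> - h (x + s *\<^sub>R (y - x)) - - h x"
      by (simp add: algebra_simps)
  qed
  then show ?thesis by (simp add: bregman_def)
qed

text \<open>Moving from the minimizer \<open>z\<close> towards \<open>y\<close> cannot lower the
  objective. All its terms except \<open>h\<close> are affine, so this is a linear lower bound on
  the increment of \<open>h\<close>, and its limit is the variational inequality at
  \<open>z\<close>. The three-point identity for the Bregman divergence then rewrites it.\<close>

lemma mirror_step_three_point:
  assumes Q: "convex Q" and h: "cont_diff_on n Q h h'" and y: "y \<in> Q"
    and m: "is_arg_min (\<lambda>y. \<eta> * dot p y + bregman h h' y x) (\<lambda>y. y \<in> Q) z"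
  shows "\<eta> * dot p (z - y) \<le> bregman h h' y x - bregman h h' y z - bregman h h' z x"
proof -
  have z: "z \<in> Q" and
    min: "\<And>w. w \<in> Q \<Longrightarrow> \<eta> * dot p z + bregman h h' z x \<le> \<eta> * dot p w + bregman h h' w x"
    using m by (auto simp: is_arg_min_linorder)
  have "dot (h' x) (y - z) - \<eta> * dot p (y - z) \<le> dot (h' z) (y - z)"
  proof (rule directional_derivative_ge[OF Q z y])
    show "(h has_derivative dot (h' z)) (at z within Q)"
      using h z by (simp add: cont_diff_on_def)
    fix s :: real assume "0 < s" "s \<le> 1"
    then have "(1 - s) *\<^sub>R z + s *\<^sub>R y \<in> Q"
      using Q z y by (auto intro: convexD_alt)
    then have "z + s *\<^sub>R (y - z) \<in> Q" by (simp add: algebra_simps)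
    from min[OF this]
    show "s * (dot (h' x) (y - z) - \<eta> * dot p (y - z)) \<le> h (z + s *\<^sub>R (y - z)) - h z"
      by (simp add: bregman_def dot_add_right dot_diff_right dot_scaleR_right algebra_simps)
  qed
  then show ?thesis
    by (simp add: bregman_def dot_diff_right algebra_simps)
qed

text \<open>Splits \<open>x - y\<close> into \<open>x - z\<close> and \<open>z - y\<close>. Relative
  Lipschitz continuity controls the first piece, the three-point inequality the second, and strong
  convexity turns the slope into a function gap with the extra term in \<open>\<mu>\<close>.\<close>

lemma mirror_step_strongly_convex:
  assumes Q: "convex Q" and h: "convex_on Q h" "cont_diff_on n Q h h'"
    and x: "x \<in> Q" and y: "y \<in> Q" and \<eta>: "\<eta> > 0"
    and F: "rel_Lipschitz h h' Q L F F'" "rel_strongly_convex h h' Q \<mu> F F'" and "L \<le> M"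
    and m: "is_arg_min (\<lambda>y. \<eta> * dot (F' x) y + bregman h h' y x) (\<lambda>y. y \<in> Q) z"
  shows "F x - F y \<le>
    (1 / \<eta> - \<mu>) * bregman h h' y x - bregman h h' y z / \<eta> + \<eta> * M\<^sup>2 / 2"
proof -
  let ?V = "bregman h h'"
  define r where "r = sqrt (2 * ?V z x)"
  have z: "z \<in> Q" using m by (simp add: is_arg_min_def)
  have V: "?V z x \<ge> 0" using bregman_nonneg[OF Q h x z] .
  then have r: "r\<^sup>2 = 2 * ?V z x" "r \<ge> 0" by (simp_all add: r_def)
  have "dot (F' x) (z - x) + L * r \<ge> 0"
    using F(1) x z by (simp add: rel_Lipschitz_def r_def)
  moreover have "L * r \<le> M * r" using \<open>L \<le> M\<close> r(2) by (rule mult_right_mono)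
  ultimately have "dot (F' x) (x - z) \<le> M * r" by (simp add: dot_diff_right)
  then have "\<eta> * dot (F' x) (x - z) \<le> \<eta> * (M * r)" using \<eta> by simp
  \<comment> \<open>Young's inequality: \<open>r\<^sup>2 / 2\<close> is exactly
    \<open>?V z x\<close>, which the three-point inequality subtracts.\<close>
  also have "\<dots> \<le> (\<eta> * M)\<^sup>2 / 2 + r\<^sup>2 / 2"
    using sum_squares_bound[of "\<eta> * M" r] by (simp add: algebra_simps)
  finally have "\<eta> * dot (F' x) (x - y) \<le> ?V y x - ?V y z + (\<eta> * M)\<^sup>2 / 2"
    using mirror_step_three_point[OF Q h(2) y m] r(1) by (simp add: dot_diff_right algebra_simps)
  then have "dot (F' x) (x - y) \<le> (?V y x - ?V y z) / \<eta> + \<eta> * M\<^sup>2 / 2"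
    using \<eta> by (simp add: field_simps power2_eq_square)
  moreover have "F x - F y \<le> dot (F' x) (x - y) - \<mu> * ?V y x"
    using F(2) x y by (auto simp: rel_strongly_convex_def dot_diff_right algebra_simps)
  ultimately show ?thesis by (simp add: algebra_simps diff_divide_distrib)
qed

section \<open>Summation over all steps\<close>

lemma sum_inverse_le_one_plus_ln:
  assumes "N \<ge> 1"
  shows "(\<Sum>t = 1..N. 1 / real t) \<le> 1 + ln (real N)"
  using assms
proof (induction N rule: nat_induct_at_least)
  case base
  then show ?case by simp
next
  case (Suc n)
  have "ln (real n / real (Suc n)) \<le> real n / real (Suc n) - 1"
    using Suc.hyps by (intro ln_le_minus_one) simp
  then have "1 / real (Suc n) \<le> ln (real (Suc n)) - ln (real n)"
    using Suc.hyps by (simp add: ln_div field_simps)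
  with Suc.IH show ?case by simp
qed

text \<open>The step size counts productive and non-productive steps alike, so the telescoping runs
  over all of \<open>{1..N}\<close> against one feasible comparator \<open>y\<close>.\<close>

lemma switching_regret_bound:
  fixes T :: nat
  assumes T: "T \<ge> 1" and \<mu>: "\<mu> > 0" and Q: "convex Q" and h: "convex_on Q h" "cont_diff_on n Q h h'"
    and f: "\<And>t. t \<in> {1..N} \<Longrightarrow> rel_Lipschitz h h' Q M\<^sub>f (f t) (f' t)"
      "\<And>t. t \<in> {1..N} \<Longrightarrow> rel_strongly_convex h h' Q \<mu> (f t) (f' t)"
    and g: "rel_Lipschitz h h' Q M\<^sub>g g g'" "rel_strongly_convex h h' Q \<mu> g g'"
    and M: "M\<^sub>f \<le> M" "M\<^sub>g \<le> M"
    and run: "switching_MD_run Q h h' f' g g' \<epsilon> \<mu> T x N"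
    and y: "y \<in> Q" "g y \<le> 0"
  shows "(\<Sum>t\<in>productive g \<epsilon> x N. f t (x t) - f t y) + \<epsilon> * real (card (nonproductive g \<epsilon> x N))
    \<le> M\<^sup>2 / (2 * \<mu>) * (1 + ln (real N))"
proof -
  let ?I = "productive g \<epsilon> x N" and ?J = "nonproductive g \<epsilon> x N" and ?V = "bregman h h'"
  have x1: "x 1 \<in> Q" and card: "card ?I = T"
    using run by (auto simp: switching_MD_run_def)
  have step: "is_arg_min (\<lambda>y. 1 / (\<mu> * real t) * dot (if g (x t) \<le> \<epsilon> then f' t (x t) else g' (x t)) y
      + ?V y (x t)) (\<lambda>y. y \<in> Q) (x (Suc t))" if "t \<in> {1..N}" for t
    using run that by (auto simp: switching_MD_run_def Let_def)
  have xQ: "x t \<in> Q" if "1 \<le> t" "t \<le> Suc N" for t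
    using that
  proof (induction t rule: nat_induct_at_least)
    case (Suc t)
    then show ?case using step[of t] by (auto simp: is_arg_min_def)
  qed (use x1 in simp)
  have N: "N \<ge> 1"
    using card T by (cases N) (auto simp: productive_def)
  \<comment> \<open>The gap at \<open>y\<close> of whichever function supplies the direction of step
    \<open>t\<close>.\<close>
  define a where "a t = (if g (x t) \<le> \<epsilon> then f t (x t) - f t y else g (x t) - g y)" for t
  \<comment> \<open>Since \<open>1 / \<eta> - \<mu> = \<mu> * (t - 1)\<close>, the weight of
    \<open>?V y (x t)\<close> equals the one left by the previous step, and it vanishes at
    \<open>t = 1\<close>. Hence no initial divergence appears in the sum.\<close>
  have a: "a t \<le> \<mu> * real (t - 1) * ?V y (x t) - \<mu> * real t * ?V y (x (Suc t)) + M\<^sup>2 / (2 * \<mu>) * (1 / real t)"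
    if t: "t \<in> {1..N}" for t
  proof -
    have \<eta>: "1 / (\<mu> * real t) > 0" and xt: "x t \<in> Q" using t \<mu> xQ by auto
    have "a t \<le> (1 / (1 / (\<mu> * real t)) - \<mu>) * ?V y (x t)
        - ?V y (x (Suc t)) / (1 / (\<mu> * real t)) + 1 / (\<mu> * real t) * M\<^sup>2 / 2"
    proof (cases "g (x t) \<le> \<epsilon>")
      case True
      show ?thesis
        using mirror_step_strongly_convex[OF Q h xt y(1) \<eta> f(1)[OF t] f(2)[OF t] M(1)] step[OF t] True
        by (simp add: a_def)
    next
      case False
      show ?thesis
        using mirror_step_strongly_convex[OF Q h xt y(1) \<eta> g M(2)] step[OF t] False
        by (simp add: a_def)
    qed
    then show ?thesis using t \<mu> by (simp add: of_nat_diff algebra_simps)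
  qed
  have tele: "(\<Sum>t = 1..k. \<mu> * real (t - 1) * ?V y (x t) - \<mu> * real t * ?V y (x (Suc t)))
      = - (\<mu> * real k * ?V y (x (Suc k)))" for k
    by (induction k) simp_all
  have "?V y (x (Suc N)) \<ge> 0" using bregman_nonneg[OF Q h] xQ[of "Suc N"] y by simp
  then have tele0: "(\<Sum>t = 1..N. \<mu> * real (t - 1) * ?V y (x t) - \<mu> * real t * ?V y (x (Suc t))) \<le> 0"
    unfolding tele using \<mu> by simp
  have "sum a {1..N} \<le> (\<Sum>t = 1..N. \<mu> * real (t - 1) * ?V y (x t) - \<mu> * real t * ?V y (x (Suc t))
      + M\<^sup>2 / (2 * \<mu>) * (1 / real t))"
    by (rule sum_mono) (rule a)
  also have "\<dots> \<le> M\<^sup>2 / (2 * \<mu>) * (\<Sum>t = 1..N. 1 / real t)"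
    using tele0 by (simp only: sum.distrib sum_distrib_left)
  also have "\<dots> \<le> M\<^sup>2 / (2 * \<mu>) * (1 + ln (real N))"
    using \<mu> by (intro mult_left_mono sum_inverse_le_one_plus_ln N) simp
  finally have upper: "sum a {1..N} \<le> M\<^sup>2 / (2 * \<mu>) * (1 + ln (real N))" .
  have "sum a {1..N} = sum a ?I + sum a ?J"
    unfolding nonproductive_def by (subst sum.subset_diff[of ?I]) (auto simp: productive_def)
  moreover have "sum a ?I = (\<Sum>t\<in>?I. f t (x t) - f t y)"
    by (intro sum.cong) (auto simp: a_def productive_def)
  \<comment> \<open>On \<open>?J\<close>, \<open>g (x t) > \<epsilon>\<close> while
    \<open>g y \<le> 0\<close>.\<close>
  moreover have "sum a ?J \<ge> (\<Sum>t\<in>?J. \<epsilon>)"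
    using y(2) by (intro sum_mono) (auto simp: a_def productive_def nonproductive_def)
  ultimately show ?thesis using upper by (simp add: mult.commute)
qed

section \<open>Choice of the constants and the final estimates\<close>

theorem theorem1:
  shows "\<exists>C K :: real. 2 < C \<and> C < 3 \<and> 0 < K \<and>
    (\<forall>(n :: nat) (Q :: rvec set) (h :: rvec \<Rightarrow> real) (h' :: rvec \<Rightarrow> rvec)
      (f :: nat \<Rightarrow> rvec \<Rightarrow> real) (f' :: nat \<Rightarrow> rvec \<Rightarrow> rvec)
      (g :: rvec \<Rightarrow> real) (g' :: rvec \<Rightarrow> rvec)
      (M\<^sub>f :: real) (M\<^sub>g :: real) (M :: real) (\<mu> :: real) (\<epsilon> :: real)
      (T :: nat) (x :: nat \<Rightarrow> rvec) (N :: nat) (I :: nat set) (J :: nat set).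
      T \<ge> 1 \<and> \<mu> > 0 \<and>
      Q \<subseteq> Rn n \<and> closed Q \<and> convex Q \<and>
      convex_on Q h \<and> cont_diff_on n Q h h' \<and>
      (\<forall>t\<in>{1..N}. subgradient_on n Q (f t) (f' t) \<and>
         rel_Lipschitz h h' Q M\<^sub>f (f t) (f' t) \<and>
         rel_strongly_convex h h' Q \<mu> (f t) (f' t)) \<and>
      subgradient_on n Q g g' \<and>
      rel_Lipschitz h h' Q M\<^sub>g g g' \<and>
      rel_strongly_convex h h' Q \<mu> g g' \<and>
      M = max M\<^sub>f M\<^sub>g \<and>
      \<epsilon> = M\<^sup>2 / \<mu> * ((1 + ln (real T)) / real T) \<and>
      switching_MD_run Q h h' f' g g' \<epsilon> \<mu> T x N \<and>
      I = productive g \<epsilon> x N \<and>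
      J = nonproductive g \<epsilon> x N \<and>
      (\<exists>x\<^sub>s. is_arg_min (\<lambda>z. \<Sum>t\<in>I. f t z) (\<lambda>z. z \<in> Q \<and> g z \<le> 0) x\<^sub>s) \<and>
      regret Q f g I x \<ge> 0
      \<longrightarrow>
      real (card J) \<le> C * real T \<and>
      regret Q f g I x \<le> M\<^sup>2 / \<mu> * (1 + ln ((C + 1) * real T)) \<and>
      M\<^sup>2 / \<mu> * (1 + ln ((C + 1) * real T)) \<le> K * (real T * \<epsilon>) \<and>
      (\<forall>t\<in>I. g (x t) \<le> \<epsilon>))"
proof -
  \<comment> \<open>The witnesses are \<open>C = 5/2\<close> and \<open>K = 7/2\<close>. The ratio
    \<open>r\<close> below turns out to be at most 1, so the midpoint of the prescribed interval is
    safe for \<open>C\<close>.\<close>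
  have main: "real (card J) \<le> 5/2 * real T \<and>
      regret Q f g I x \<le> M\<^sup>2 / \<mu> * (1 + ln ((5/2 + 1) * real T)) \<and>
      M\<^sup>2 / \<mu> * (1 + ln ((5/2 + 1) * real T)) \<le> 7/2 * (real T * \<epsilon>) \<and>
      (\<forall>t\<in>I. g (x t) \<le> \<epsilon>)"
    if T: "T \<ge> 1" and \<mu>: "\<mu> > 0" and Q: "convex Q" and h: "convex_on Q h" "cont_diff_on n Q h h'"
      and f: "\<And>t. t \<in> {1..N} \<Longrightarrow> rel_Lipschitz h h' Q M\<^sub>f (f t) (f' t)"
        "\<And>t. t \<in> {1..N} \<Longrightarrow> rel_strongly_convex h h' Q \<mu> (f t) (f' t)"
      and g: "rel_Lipschitz h h' Q M\<^sub>g g g'" "rel_strongly_convex h h' Q \<mu> g g'"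
      and M: "M = max M\<^sub>f M\<^sub>g"
      and \<epsilon>: "\<epsilon> = M\<^sup>2 / \<mu> * ((1 + ln (real T)) / real T)"
      and run: "switching_MD_run Q h h' f' g g' \<epsilon> \<mu> T x N"
      and I: "I = productive g \<epsilon> x N" and J: "J = nonproductive g \<epsilon> x N"
      and ex: "\<exists>x\<^sub>s. is_arg_min (\<lambda>z. \<Sum>t\<in>I. f t z) (\<lambda>z. z \<in> Q \<and> g z \<le> 0) x\<^sub>s"
      and reg: "regret Q f g I x \<ge> 0"
    for n :: nat and Q :: "rvec set" and h h' and f :: "nat \<Rightarrow> rvec \<Rightarrow> real" and f' g g'
      and M\<^sub>f M\<^sub>g M \<mu> \<epsilon> :: real and T :: nat and x :: "nat \<Rightarrow> rvec" and N :: nat and I J :: "nat set"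
  proof -
    obtain y where y: "y \<in> Q" "g y \<le> 0"
      and min: "\<And>z. z \<in> Q \<Longrightarrow> g z \<le> 0 \<Longrightarrow> (\<Sum>t\<in>I. f t y) \<le> (\<Sum>t\<in>I. f t z)"
      using ex by (auto simp: is_arg_min_linorder)
    \<comment> \<open>Attainment makes the real infimum in \<open>regret\<close> a genuine minimum,
      so \<open>y\<close> can be the comparator.\<close>
    have "(INF z\<in>{z\<in>Q. g z \<le> 0}. \<Sum>t\<in>I. f t z) = (\<Sum>t\<in>I. f t y)"
      by (rule cInf_eq_minimum) (use y min in auto)
    then have R: "regret Q f g I x = (\<Sum>t\<in>I. f t (x t) - f t y)"
      by (simp add: regret_def sum_subtractf)
    have cI: "card I = T" using run I by (simp add: switching_MD_run_def)
    have "I \<subseteq> {1..N}" by (auto simp: I productive_def)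
    then have "card J = N - T" "T \<le> N"
      using cI card_mono[of "{1..N}" I] by (auto simp: J nonproductive_def I[symmetric] card_Diff_subset finite_subset)
    then have N: "real N = real T + real (card J)" by simp
    define L where "L = ln (real T)"
    define r where "r = real (card J) / real T"
    have L: "L \<ge> 0" and r: "r \<ge> 0" using T by (simp_all add: L_def r_def)
    have rT: "real (card J) = r * real T" using T by (simp add: r_def)
    have "M > 0" using g(1) by (auto simp: rel_Lipschitz_def M)
    then have c: "M\<^sup>2 / \<mu> > 0" (is "?c > 0") using \<mu> by simp
    have "real N = (1 + r) * real T" by (simp add: N rT algebra_simps)
    then have lnN: "ln (real N) = ln (1 + r) + L"
      using T r by (simp add: L_def ln_mult)
    have T\<epsilon>: "real T * \<epsilon> = ?c * (1 + L)" using T by (simp add: \<epsilon> L_def)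
    have "regret Q f g I x + \<epsilon> * real (card J) \<le> M\<^sup>2 / (2 * \<mu>) * (1 + ln (real N))"
      unfolding R unfolding I J
      by (rule switching_regret_bound[where f = f and f' = f', OF T \<mu> Q h _ _ g _ _ run y])
        (use f in \<open>auto simp: M\<close>)
    moreover have "\<epsilon> * real (card J) = ?c * ((1 + L) * r)"
      using arg_cong[OF T\<epsilon>, of "(*) r"] by (simp add: rT algebra_simps)
    moreover have "M\<^sup>2 / (2 * \<mu>) * (1 + ln (real N)) = ?c * ((1 + L + ln (1 + r)) / 2)"
      by (simp add: lnN field_simps)
    ultimately have bound: "regret Q f g I x + ?c * ((1 + L) * r) \<le> ?c * ((1 + L + ln (1 + r)) / 2)"
      by simp
    \<comment> \<open>The only use of the sign of the regret: dropping it leaves an inequality in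
      \<open>r\<close> and \<open>L\<close> alone.\<close>
    then have "?c * ((1 + L) * r) \<le> ?c * ((1 + L + ln (1 + r)) / 2)"
      using reg by linarith
    then have "(1 + L) * r \<le> (1 + L + ln (1 + r)) / 2"
      using c by (simp only: mult_le_cancel_left_pos)
    moreover have lnr: "ln (1 + r) \<le> r" using r by (rule ln_add_one_self_le_self)
    moreover have "r \<le> (1 + L) * r" using L r by (simp add: algebra_simps)
    \<comment> \<open>With \<open>u = (1 + L) * r\<close> as an atom:
      \<open>2 * u \<le> 1 + L + ln (1 + r) \<le> 1 + L + u\<close>.\<close>
    ultimately have "(1 + L) * r \<le> (1 + L) * 1" by argo
    then have r1: "r \<le> 1" using L by (simp only: mult_le_cancel_left_pos)
    define k where "k = ln (7/2 :: real)"
    have k: "0 \<le> k" "k \<le> 5/2"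
      using ln_le_minus_one[of "7/2 :: real"] by (auto simp: k_def)
    have lnC: "ln ((5/2 + 1) * real T) = k + L"
      using T ln_mult[of "7/2" "real T"] by (simp add: L_def k_def)
    have J_le: "real (card J) \<le> 5/2 * real T"
      unfolding rT using r1 by (intro mult_right_mono) auto
    have ln1: "ln (1 + r) \<le> k" using r r1 by (simp add: k_def)
    \<comment> \<open>Now the contribution of the non-productive steps is dropped instead of the
      regret.\<close>
    have "0 \<le> ?c * ((1 + L) * r)" using c L r by (intro mult_nonneg_nonneg) auto
    then have "regret Q f g I x \<le> ?c * ((1 + L + ln (1 + r)) / 2)" using bound by linarith
    also have "\<dots> \<le> ?c * (1 + ln ((5/2 + 1) * real T))"
      unfolding lnC using c L ln1 k by (intro mult_left_mono) (auto simp: field_simps)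
    finally have reg_le: "regret Q f g I x \<le> ?c * (1 + ln ((5/2 + 1) * real T))" .
    \<comment> \<open>\<open>K\<close> comes from \<open>1 + k \<le> 7/2\<close>, the bound
      \<open>ln u \<le> u - 1\<close> at \<open>u = 7/2\<close>; the remaining \<open>L\<close> is
      covered since \<open>L \<ge> 0\<close>.\<close>
    have "?c * (1 + ln ((5/2 + 1) * real T)) \<le> ?c * (7/2 * (1 + L))"
      unfolding lnC using c L k by (intro mult_left_mono) auto
    also have "\<dots> = 7/2 * (real T * \<epsilon>)"
      unfolding T\<epsilon> by (rule mult.left_commute)
    finally have "?c * (1 + ln ((5/2 + 1) * real T)) \<le> 7/2 * (real T * \<epsilon>)" .
    with J_le reg_le show ?thesis by (auto simp: I productive_def)
  qed
  show ?thesis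
    by (rule exI[of _ "5/2"], rule exI[of _ "7/2"], intro conjI allI impI; (elim conjE)?)
      (simp, simp, simp, (rule main[THEN conjunct1]; blast),
       (rule main[THEN conjunct2, THEN conjunct1]; blast),
       (rule main[THEN conjunct2, THEN conjunct2, THEN conjunct1]; blast), blast dest: main)
qed

end
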